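(* Let $\mathcal C(\theta)=(x(\theta),y(\theta),z(\theta))$, $\theta\in\mathbb{R}$, be a parametrized curve in $H_1$ and define $$Y(r,\theta)=\big(x(\theta)+r\cos\theta,\ y(\theta)+r\sin\theta,\ z(\theta)+r\,y(\theta)\cos\theta-r\,x(\theta)\sin\theta\big),\qquad r\in\mathbb{R}.$$ The surface $Y$ defines a $p$-minimal surface of general type if the curve $\mathcal C$ satisfies $$z'(\theta)+x(\theta)y'(\theta)-y(\theta)x'(\theta)-\big(y'(\theta)\cos\theta-x'(\theta)\sin\theta\big)^2\neq0\quad\text{for all }\theta.$$ In addition, the corresponding $\zeta_1$- and $\zeta_2$-invariants read $$\zeta_1(\theta)=y'(\theta)\cos\theta-x'(\theta)\sin\theta-\int\big[x'(\theta)\cos\theta+y'(\theta)\sin\theta\big]d\theta,$$ $$\zeta_2(\theta)=z'(\theta)+x(\theta)y'(\theta)-y(\theta)x'(\theta)-\big(y'(\theta)\cos\theta-x'(\theta)\sin\theta\big)^2,$$ where $\int[x'(\theta)\cos\theta+y'(\theta)\sin\theta]d\theta$ is an anti-derivative of the function $x'(\theta)\cos\theta+y'(\theta)\sin\theta$.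
   Context: The Heisenberg group $H_1$ is $\mathbb{R}^3$ with the group law $(x_1,y_1,z_1)\circ(x_2,y_2,z_2)=(x_1+x_2,\,y_1+y_2,\,z_1+z_2+y_1x_2-x_1y_2)$. Left invariant fields: $\mathring e_1=\partial_x+y\partial_z$, $\mathring e_2=\partial_y-x\partial_z$, $T=\partial_z$. Contact form $\Theta=dz+x\,dy-y\,dx$, contact bundle $\xi=\ker\Theta$, $J\mathring e_1=\mathring e_2$, $J\mathring e_2=-\mathring e_1$. The adapted metric makes $\mathring e_1,\mathring e_2,T$ orthonormal; $\nabla$ is the connection for which they are parallel. All objects are $C^\infty$. For a surface in $H_1$, a point is singular if the tangent plane there equals the contact plane, otherwise regular. On the regular part choose a unit tangent field $e_1\in\xi$ (determined up to sign; for $Y$ one takes $e_1=Y_r$) and put $e_2=Je_1$; the $p$-mean curvature $H$ is defined by $\nabla_{e_1}e_2=-He_1$, and $p$-minimal means $H=0$ on the whole regular part. The $\alpha$-function is the function on the regular part such that $\alpha e_2+T$ is tangent to the surface; put $\hat e_2=\frac{\alpha e_2+T}{\sqrt{1+\alpha^2}}$. Types and invariants are notions on the regular part. A $p$-minimal surface is (locally) of general type if there are coordinates $(\tilde x,\tilde y)$ with $e_1=\partial_{\tilde x}$ in which $\alpha=\frac{\tilde x+c_1(\tilde y)}{(\tilde x+c_1(\tilde y))^2+c_2(\tilde y)}$ with $c_2(\tilde y)\neq0$ for all $\tilde y$. In that case the coordinates can be normalized (normal coordinates) so that $\hat e_2=b\,\partial_{\tilde y}$ with $b=\frac{|\alpha|}{|\tilde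 x+\zeta_1(\tilde y)|\sqrt{1+\alpha^2}}$ (in particular $b>0$) and $\alpha=\frac{\tilde x+\zeta_1(\tilde y)}{(\tilde x+\zeta_1(\tilde y))^2+\zeta_2(\tilde y)}$. The functions $\zeta_1,\zeta_2$ are called the $\zeta_1$- and $\zeta_2$-invariants; $\zeta_2$ is unique up to a translation in $\tilde y$, and $\zeta_1$ is unique up to a translation in $\tilde y$ and an additive constant.
   Formalization: Where z'+xy'-yx'+2r(y'cos θ-x'sin θ)+r² is negative, b>0 forces the normal coordinate to be -θ, so there the invariants as functions of the normal coordinate t are the displayed formulas evaluated at θ=-t; elsewhere on the regular part they are as displayed. *)

theory Defs
  imports "HOL-Analysis.Analysis"
begin

section \<open>Smooth maps\<close>

primrec times_differentiable_on ::
  "nat \<Rightarrow> 'a::real_normed_vector set \<Rightarrow> ('a \<Rightarrow> 'b::real_normed_vector) \<Rightarrow> bool" where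
  "times_differentiable_on 0 S f \<longleftrightarrow> continuous_on S f"
| "times_differentiable_on (Suc n) S f \<longleftrightarrow>
     (\<forall>x\<in>S. f differentiable (at x)) \<and>
     (\<forall>v. times_differentiable_on n S (\<lambda>x. frechet_derivative f (at x) v))"

text \<open>Only meant for open \<open>S\<close>, since the derivatives are taken in full neighbourhoods.\<close>

definition smooth_on ::
  "'a::real_normed_vector set \<Rightarrow> ('a \<Rightarrow> 'b::real_normed_vector) \<Rightarrow> bool" where
  "smooth_on S f \<longleftrightarrow> (\<forall>n. times_differentiable_on n S f)"


section \<open>The Heisenberg group\<close>

text \<open>Both points and tangent vectors are triples; a tangent vector \<open>(a, b, c)\<close> stands for
  \<open>a \<partial>\<^sub>x + b \<partial>\<^sub>y + c \<partial>\<^sub>z\<close>, and the base point is passed separately.\<close>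

type_synonym heis = "real \<times> real \<times> real"
type_synonym plane = "real \<times> real"

definition heis_mult :: "heis \<Rightarrow> heis \<Rightarrow> heis" where
  "heis_mult = (\<lambda>(x1, y1, z1) (x2, y2, z2). (x1 + x2, y1 + y2, z1 + z2 + y1 * x2 - x1 * y2))"

definition left_X :: "heis \<Rightarrow> heis" where
  "left_X = (\<lambda>(x, y, z). (1, 0, y))"

definition left_Y :: "heis \<Rightarrow> heis" where
  "left_Y = (\<lambda>(x, y, z). (0, 1, - x))"

definition left_T :: "heis \<Rightarrow> heis" where
  "left_T = (\<lambda>(x, y, z). (0, 0, 1))"

lemma left_invariant_frame:
  "frechet_derivative (heis_mult p) (at q) (left_X q) = left_X (heis_mult p q)"
  "frechet_derivative (heis_mult p) (at q) (left_Y q) = left_Y (heis_mult p q)"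
  "frechet_derivative (heis_mult p) (at q) (left_T q) = left_T (heis_mult p q)"
proof -
  obtain x y z where p: "p = (x, y, z)" by (cases p)
  have "(heis_mult p has_derivative
      (\<lambda>v. (fst v, fst (snd v), snd (snd v) + y * fst v - x * fst (snd v)))) (at q)"
    unfolding heis_mult_def p case_prod_unfold
    by (auto intro!: derivative_eq_intros simp: fun_eq_iff)
  then have D: "frechet_derivative (heis_mult p) (at q) =
      (\<lambda>v. (fst v, fst (snd v), snd (snd v) + y * fst v - x * fst (snd v)))"
    by (rule frechet_derivative_at [symmetric])
  show "frechet_derivative (heis_mult p) (at q) (left_X q) = left_X (heis_mult p q)"
    "frechet_derivative (heis_mult p) (at q) (left_Y q) = left_Y (heis_mult p q)"
    "frechet_derivative (heis_mult p) (at q) (left_T q) = left_T (heis_mult p q)"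
    unfolding D
    by (cases q; simp add: p heis_mult_def left_X_def left_Y_def left_T_def)+
qed

definition contact_form :: "heis \<Rightarrow> heis \<Rightarrow> real" where
  "contact_form = (\<lambda>(x, y, z) (a, b, c). c + x * b - y * a)"

definition contact_plane :: "heis \<Rightarrow> heis set" where
  "contact_plane p = {v. contact_form p v = 0}"

text \<open>The frame \<open>left_X, left_Y, left_T\<close> has dual coframe \<open>dx, dy, \<Theta>\<close>, so the components of
  \<open>v\<close> in it are \<open>fst v\<close>, \<open>fst (snd v)\<close> and \<open>contact_form p v\<close>.\<close>

lemma frame_decomposition:
  "v = fst v *\<^sub>R left_X p + fst (snd v) *\<^sub>R left_Y p + contact_form p v *\<^sub>R left_T p"
  by (cases p; cases v) (simp add: left_X_def left_Y_def left_T_def contact_form_def algebra_simps)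

definition adapted_metric :: "heis \<Rightarrow> heis \<Rightarrow> heis \<Rightarrow> real" where
  "adapted_metric p v w =
     fst v * fst w + fst (snd v) * fst (snd w) + contact_form p v * contact_form p w"

lemma adapted_metric_frame:
  "adapted_metric p (left_X p) (left_X p) = 1" "adapted_metric p (left_X p) (left_Y p) = 0"
  "adapted_metric p (left_Y p) (left_Y p) = 1" "adapted_metric p (left_X p) (left_T p) = 0"
  "adapted_metric p (left_T p) (left_T p) = 1" "adapted_metric p (left_Y p) (left_T p) = 0"
  by (cases p; simp add: adapted_metric_def left_X_def left_Y_def left_T_def contact_form_def)+

text \<open>Only used on contact vectors; outside the contact plane this is the extension with
  \<open>J T = 0\<close>.\<close>

definition heis_J :: "heis \<Rightarrow> heis \<Rightarrow> heis" where
  "heis_J p v = fst v *\<^sub>R left_Y p - fst (snd v) *\<^sub>R left_X p"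

lemma heis_J_frame:
  "heis_J p (left_X p) = left_Y p" "heis_J p (left_Y p) = - left_X p"
  by (cases p; simp add: heis_J_def left_X_def left_Y_def)+

text \<open>Covariant derivative, in the parameter direction \<open>u\<close>, of a vector field \<open>W\<close> along the map
  \<open>X\<close>, for the connection with parallel frame \<open>left_X, left_Y, left_T\<close>: the frame components
  of \<open>W\<close> are differentiated.\<close>

definition cov_deriv :: "(plane \<Rightarrow> heis) \<Rightarrow> (plane \<Rightarrow> heis) \<Rightarrow> plane \<Rightarrow> plane \<Rightarrow> heis" where
  "cov_deriv X W q u =
     frechet_derivative (\<lambda>p. fst (W p)) (at q) u *\<^sub>R left_X (X q) +
     frechet_derivative (\<lambda>p. fst (snd (W p))) (at q) u *\<^sub>R left_Y (X q) +
     frechet_derivative (\<lambda>p. contact_form (X p) (W p)) (at q) u *\<^sub>R left_T (X q)"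


section \<open>Surfaces\<close>

text \<open>A surface is an immersed one, given by a parametrization \<open>X\<close> on an open set \<open>U\<close> of the
  plane. Functions and vector fields on the surface are functions of the parameter.\<close>

definition immersed_surface :: "plane set \<Rightarrow> (plane \<Rightarrow> heis) \<Rightarrow> bool" where
  "immersed_surface U X \<longleftrightarrow>
     open U \<and> smooth_on U X \<and> (\<forall>q\<in>U. inj (frechet_derivative X (at q)))"

definition tangent_plane :: "(plane \<Rightarrow> heis) \<Rightarrow> plane \<Rightarrow> heis set" where
  "tangent_plane X q = range (frechet_derivative X (at q))"

definition regular_part :: "plane set \<Rightarrow> (plane \<Rightarrow> heis) \<Rightarrow> plane set" where
  "regular_part U X = {q\<in>U. tangent_plane X q \<noteq> contact_plane (X q)}"

definition characteristic_field :: "plane set \<Rightarrow> (plane \<Rightarrow> heis) \<Rightarrow> (plane \<Rightarrow> heis) \<Rightarrow> bool" where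
  "characteristic_field U X e1 \<longleftrightarrow>
     smooth_on (regular_part U X) e1 \<and>
     (\<forall>q\<in>regular_part U X. e1 q \<in> tangent_plane X q \<inter> contact_plane (X q) \<and>
        adapted_metric (X q) (e1 q) (e1 q) = 1)"

definition field_e2 :: "(plane \<Rightarrow> heis) \<Rightarrow> (plane \<Rightarrow> heis) \<Rightarrow> plane \<Rightarrow> heis" where
  "field_e2 X e1 q = heis_J (X q) (e1 q)"

text \<open>In the next definition \<open>u\<close> is the parameter direction that represents the tangent
  vector \<open>e1 q\<close>.\<close>

definition p_mean_curvature :: "(plane \<Rightarrow> heis) \<Rightarrow> (plane \<Rightarrow> heis) \<Rightarrow> plane \<Rightarrow> real" where
  "p_mean_curvature X e1 q =
     (THE H. \<exists>u. frechet_derivative X (at q) u = e1 q \<and>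
        cov_deriv X (field_e2 X e1) q u = - (H *\<^sub>R e1 q))"

definition p_minimal :: "plane set \<Rightarrow> (plane \<Rightarrow> heis) \<Rightarrow> (plane \<Rightarrow> heis) \<Rightarrow> bool" where
  "p_minimal U X e1 \<longleftrightarrow>
     immersed_surface U X \<and> characteristic_field U X e1 \<and>
     (\<forall>q\<in>regular_part U X. p_mean_curvature X e1 q = 0)"

definition alpha_fun :: "(plane \<Rightarrow> heis) \<Rightarrow> (plane \<Rightarrow> heis) \<Rightarrow> plane \<Rightarrow> real" where
  "alpha_fun X e1 q =
     (THE a. a *\<^sub>R field_e2 X e1 q + left_T (X q) \<in> tangent_plane X q)"

definition field_e2_hat :: "(plane \<Rightarrow> heis) \<Rightarrow> (plane \<Rightarrow> heis) \<Rightarrow> plane \<Rightarrow> heis" where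
  "field_e2_hat X e1 q =
     (1 / sqrt (1 + (alpha_fun X e1 q)\<^sup>2)) *\<^sub>R
     (alpha_fun X e1 q *\<^sub>R field_e2 X e1 q + left_T (X q))"


section \<open>Surfaces of general type and their invariants\<close>

definition coordinates_on :: "plane set \<Rightarrow> (plane \<Rightarrow> plane) \<Rightarrow> bool" where
  "coordinates_on W \<phi> \<longleftrightarrow>
     open W \<and> smooth_on W \<phi> \<and> inj_on \<phi> W \<and> open (\<phi> ` W) \<and> smooth_on (\<phi> ` W) (inv_into W \<phi>)"

text \<open>The coordinate vector fields on the surface of the coordinates
  \<open>\<phi> = (x\<^sub>\<phi>, y\<^sub>\<phi>)\<close> on \<open>W\<close>.\<close>

definition coord_x :: "(plane \<Rightarrow> heis) \<Rightarrow> plane set \<Rightarrow> (plane \<Rightarrow> plane) \<Rightarrow> plane \<Rightarrow> heis" where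
  "coord_x X W \<phi> q = frechet_derivative (X \<circ> inv_into W \<phi>) (at (\<phi> q)) (1, 0)"

definition coord_y :: "(plane \<Rightarrow> heis) \<Rightarrow> plane set \<Rightarrow> (plane \<Rightarrow> plane) \<Rightarrow> plane \<Rightarrow> heis" where
  "coord_y X W \<phi> q = frechet_derivative (X \<circ> inv_into W \<phi>) (at (\<phi> q)) (0, 1)"

text \<open>The condition that the denominator does not vanish is explicit because of the convention
  \<open>a / 0 = 0\<close>.\<close>

definition general_type_coordinates ::
  "plane set \<Rightarrow> (plane \<Rightarrow> heis) \<Rightarrow> (plane \<Rightarrow> heis) \<Rightarrow> plane set \<Rightarrow> (plane \<Rightarrow> plane) \<Rightarrow>
   (real \<Rightarrow> real) \<Rightarrow> (real \<Rightarrow> real) \<Rightarrow> bool" where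
  "general_type_coordinates U X e1 W \<phi> c1 c2 \<longleftrightarrow>
     W \<subseteq> regular_part U X \<and> coordinates_on W \<phi> \<and>
     smooth_on (snd ` \<phi> ` W) c1 \<and> smooth_on (snd ` \<phi> ` W) c2 \<and>
     (\<forall>t \<in> snd ` \<phi> ` W. c2 t \<noteq> 0) \<and>
     (\<forall>q\<in>W. \<forall>s t. \<phi> q = (s, t) \<longrightarrow>
        e1 q = coord_x X W \<phi> q \<and>
        (s + c1 t)\<^sup>2 + c2 t \<noteq> 0 \<and>
        alpha_fun X e1 q = (s + c1 t) / ((s + c1 t)\<^sup>2 + c2 t))"

definition p_minimal_general_type ::
  "plane set \<Rightarrow> (plane \<Rightarrow> heis) \<Rightarrow> (plane \<Rightarrow> heis) \<Rightarrow> bool" where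
  "p_minimal_general_type U X e1 \<longleftrightarrow>
     p_minimal U X e1 \<and>
     (\<forall>q\<in>regular_part U X. \<exists>W \<phi> c1 c2. q \<in> W \<and> general_type_coordinates U X e1 W \<phi> c1 c2)"

text \<open>Normal coordinates, with the invariants \<open>\<zeta>1\<close> and \<open>\<zeta>2\<close> read off in them. Where
  \<open>s + \<zeta>1 t = 0\<close> (equivalently \<open>\<alpha> = 0\<close>) the formula for \<open>b\<close> has the form \<open>0/0\<close>, and \<open>b\<close> is
  its smooth extension. The condition \<open>b > 0\<close> fixes the orientation of the second coordinate.\<close>

definition normal_coordinates ::
  "plane set \<Rightarrow> (plane \<Rightarrow> heis) \<Rightarrow> (plane \<Rightarrow> heis) \<Rightarrow> plane set \<Rightarrow> (plane \<Rightarrow> plane) \<Rightarrow>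
   (real \<Rightarrow> real) \<Rightarrow> (real \<Rightarrow> real) \<Rightarrow> bool" where
  "normal_coordinates U X e1 W \<phi> \<zeta>1 \<zeta>2 \<longleftrightarrow>
     general_type_coordinates U X e1 W \<phi> \<zeta>1 \<zeta>2 \<and>
     (\<exists>b. smooth_on (\<phi> ` W) b \<and>
        (\<forall>q\<in>W. \<forall>s t. \<phi> q = (s, t) \<longrightarrow>
           b (s, t) > 0 \<and>
           field_e2_hat X e1 q = b (s, t) *\<^sub>R coord_y X W \<phi> q \<and>
           (s + \<zeta>1 t \<noteq> 0 \<longrightarrow>
              b (s, t) = \<bar>alpha_fun X e1 q\<bar> /
                (\<bar>s + \<zeta>1 t\<bar> * sqrt (1 + (alpha_fun X e1 q)\<^sup>2)))))"


section \<open>The surface swept out by Legendrian lines along a curve\<close>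

definition ruled_surface ::
  "(real \<Rightarrow> real) \<Rightarrow> (real \<Rightarrow> real) \<Rightarrow> (real \<Rightarrow> real) \<Rightarrow> plane \<Rightarrow> heis" where
  "ruled_surface x y z = (\<lambda>(r, \<theta>).
     (x \<theta> + r * cos \<theta>,
      y \<theta> + r * sin \<theta>,
      z \<theta> + r * y \<theta> * cos \<theta> - r * x \<theta> * sin \<theta>))"

text \<open>Where this sign is \<open>1\<close>, the projection of \<open>\<partial>\<^sub>\<theta>\<close> along \<open>e1\<close> is a positive multiple of
  \<open>\<alpha> e2 + T\<close>; where it is \<open>-1\<close>, a negative one.\<close>

definition theta_sign :: "(plane \<Rightarrow> heis) \<Rightarrow> plane \<Rightarrow> real" where
  "theta_sign X q = sgn (contact_form (X q) (frechet_derivative X (at q) (0, 1)))"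

end

theory Submission
  imports Defs
begin

text \<open>With \<open>A = y' cos \<theta> - x' sin \<theta>\<close> and \<open>B = x' cos \<theta> + y' sin \<theta>\<close>, the velocity \<open>Y_\<theta>\<close> of the
  ruled surface is \<open>B e1 + (r + A) e2 + D T\<close>, where \<open>D = (r + A)\<^sup>2 + \<zeta>2\<close>. Hence the
  surface is immersed when \<open>\<zeta>2\<close> has no zero, its regular part is \<open>D \<noteq> 0\<close>, and
  \<open>\<alpha> = (r + A) / D\<close>; it is \<open>p\<close>-minimal because \<open>e2\<close> is parallel along the rules. If
  \<open>G' = B\<close> and \<open>\<sigma>\<close> is the sign of \<open>D\<close>, then in the coordinates \<open>(r + G, \<sigma> \<theta>)\<close> the second
  coordinate field is \<open>\<bar>D\<bar> (\<alpha> e2 + T)\<close>, so they are normal, with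
  \<open>b = 1 / sqrt (D\<^sup>2 + (r + A)\<^sup>2)\<close>.\<close>

section \<open>Calculus of smooth maps\<close>

lemma frechet_derivative_eqI:
  "(f has_derivative f') (at x) \<Longrightarrow> frechet_derivative f (at x) v = f' v"
  by (metis frechet_derivative_at)

lemma times_differentiable_on_imp_continuous_on:
  "times_differentiable_on n S f \<Longrightarrow> continuous_on S f"
  by (cases n) (auto intro: continuous_at_imp_continuous_on differentiable_imp_continuous_within)

lemma times_differentiable_on_SucD:
  "times_differentiable_on (Suc n) S f \<Longrightarrow> times_differentiable_on n S f"
proof (induction n arbitrary: f)
  case 0
  then show ?case
    using times_differentiable_on_imp_continuous_on by (metis times_differentiable_on.simps(1))
next
  case (Suc n)
  then show ?case by (simp only: times_differentiable_on.simps) blast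
qed

lemma times_differentiable_on_subset:
  "times_differentiable_on n S f \<Longrightarrow> T \<subseteq> S \<Longrightarrow> times_differentiable_on n T f"
  by (induction n arbitrary: f) (auto intro: continuous_on_subset)

text \<open>A derivative at a point of an open set depends only on the values near that point. The
  directional derivatives therefore agree on \<open>S\<close> as well, and the induction has to run
  over arbitrary \<open>f\<close> and \<open>g\<close>.\<close>

lemma times_differentiable_on_cong:
  assumes "open S" "\<And>x. x \<in> S \<Longrightarrow> f x = g x" "times_differentiable_on n S f"
  shows "times_differentiable_on n S g"
  using assms
proof (induction n arbitrary: f g)
  case 0
  then show ?case using continuous_on_cong by (metis times_differentiable_on.simps(1))
next
  case (Suc n)
  have D: "(g has_derivative frechet_derivative f (at x)) (at x)" if "x \<in> S" for x
    using Suc.prems that frechet_derivative_works has_derivative_transform_within_open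
    by (metis times_differentiable_on.simps(2))
  show ?case
    unfolding times_differentiable_on.simps
  proof (intro conjI ballI allI)
    show "g differentiable (at x)" if "x \<in> S" for x
      using D[OF that] differentiableI by blast
    show "times_differentiable_on n S (\<lambda>x. frechet_derivative g (at x) v)" for v
      using Suc.IH[of "\<lambda>x. frechet_derivative f (at x) v"] Suc.prems
      by (simp add: frechet_derivative_eqI[OF D])
  qed
qed

text \<open>Lets an explicit formula replace the \<open>frechet_derivative\<close> of the recursive
  definition; the two agree on \<open>S\<close> by uniqueness of derivatives.\<close>

lemma times_differentiable_on_SucI:
  assumes "open S" "\<And>x. x \<in> S \<Longrightarrow> (f has_derivative f' x) (at x)"
    and "\<And>v. times_differentiable_on n S (\<lambda>x. f' x v)"
  shows "times_differentiable_on (Suc n) S f"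
  unfolding times_differentiable_on.simps
proof (intro conjI ballI allI)
  show "f differentiable (at x)" if "x \<in> S" for x
    using assms(2)[OF that] differentiableI by blast
  show "times_differentiable_on n S (\<lambda>x. frechet_derivative f (at x) v)" for v
    by (rule times_differentiable_on_cong[OF assms(1) _ assms(3)[of v]])
      (simp add: frechet_derivative_eqI[OF assms(2)])
qed

lemma times_differentiable_on_SucE:
  assumes "times_differentiable_on (Suc n) S f"
  shows "x \<in> S \<Longrightarrow> (f has_derivative frechet_derivative f (at x)) (at x)"
    and "times_differentiable_on n S (\<lambda>x. frechet_derivative f (at x) v)"
  using assms by (auto simp: frechet_derivative_works)

lemma times_differentiable_on_const: "open S \<Longrightarrow> times_differentiable_on n S (\<lambda>x. c)"
proof (induction n arbitrary: c)
  case (Suc n)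
  show ?case
    by (rule times_differentiable_on_SucI[where f' = "\<lambda>_ _. 0"]) (auto simp: Suc)
qed simp

lemma times_differentiable_on_bounded_linear:
  assumes "open S" "bounded_linear f"
  shows "times_differentiable_on n S f"
proof (cases n)
  case 0
  then show ?thesis using assms by (simp add: linear_continuous_on)
next
  case (Suc m)
  then show ?thesis
    using times_differentiable_on_SucI[OF assms(1), of f "\<lambda>_. f"] assms
    by (simp add: bounded_linear_imp_has_derivative times_differentiable_on_const)
qed

lemma times_differentiable_on_add:
  assumes "open S" "times_differentiable_on n S f" "times_differentiable_on n S g"
  shows "times_differentiable_on n S (\<lambda>x. f x + g x)"
  using assms(2,3)
proof (induction n arbitrary: f g)
  case 0
  then show ?case by (simp add: continuous_on_add)
next
  case (Suc n)
  show ?case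
    by (rule times_differentiable_on_SucI[OF assms(1)
          has_derivative_add[OF times_differentiable_on_SucE(1)[OF Suc.prems(1)]
            times_differentiable_on_SucE(1)[OF Suc.prems(2)]]])
      (assumption | rule Suc.IH[OF times_differentiable_on_SucE(2)[OF Suc.prems(1)]
          times_differentiable_on_SucE(2)[OF Suc.prems(2)]])+
qed

lemma times_differentiable_on_sum:
  assumes "open S" "\<And>i. i \<in> I \<Longrightarrow> times_differentiable_on n S (f i)"
  shows "times_differentiable_on n S (\<lambda>x. \<Sum>i\<in>I. f i x)"
  using assms(2)
  by (induction I rule: infinite_finite_induct)
    (auto intro: times_differentiable_on_const times_differentiable_on_add assms(1))

lemma times_differentiable_on_Pair:
  assumes "open S" "times_differentiable_on n S f" "times_differentiable_on n S g"
  shows "times_differentiable_on n S (\<lambda>x. (f x, g x))"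
  using assms(2,3)
proof (induction n arbitrary: f g)
  case 0
  then show ?case by (simp add: continuous_on_Pair)
next
  case (Suc n)
  show ?case
    by (rule times_differentiable_on_SucI[OF assms(1)
          has_derivative_Pair[OF times_differentiable_on_SucE(1)[OF Suc.prems(1)]
            times_differentiable_on_SucE(1)[OF Suc.prems(2)]]])
      (assumption | rule Suc.IH[OF times_differentiable_on_SucE(2)[OF Suc.prems(1)]
          times_differentiable_on_SucE(2)[OF Suc.prems(2)]])+
qed

text \<open>Serves products, scalings and inner products at once. Each term of the product rule
  keeps one undifferentiated factor, whose order \<open>times_differentiable_on_SucD\<close> lowers
  to fit the induction hypothesis.\<close>

lemma (in bounded_bilinear) times_differentiable_on_bilinear:
  assumes "open S" "times_differentiable_on n S f" "times_differentiable_on n S g"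
  shows "times_differentiable_on n S (\<lambda>x. prod (f x) (g x))"
  using assms(2,3)
proof (induction n arbitrary: f g)
  case 0
  then show ?case by (simp add: continuous_on)
next
  case (Suc n)
  show ?case
    by (rule times_differentiable_on_SucI[OF assms(1)
          FDERIV[OF times_differentiable_on_SucE(1)[OF Suc.prems(1)]
            times_differentiable_on_SucE(1)[OF Suc.prems(2)]]])
      (assumption | intro times_differentiable_on_add assms(1) Suc.IH
        times_differentiable_on_SucE(2)[OF Suc.prems(1)]
        times_differentiable_on_SucE(2)[OF Suc.prems(2)] Suc.prems[THEN times_differentiable_on_SucD])+
qed

text \<open>In the chain rule the direction fed to the derivative of \<open>g\<close> moves with the
  point, while the recursion controls fixed directions only. Expanding it in the basis of the middle
  space leaves scalar coefficients times derivatives in fixed directions.\<close>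

lemma times_differentiable_on_compose:
  fixes f :: "'a::real_normed_vector \<Rightarrow> 'b::euclidean_space" and g :: "'b \<Rightarrow> 'c::real_normed_vector"
  assumes "open S" "open T" "f ` S \<subseteq> T"
    and "times_differentiable_on n T g" "times_differentiable_on n S f"
  shows "times_differentiable_on n S (\<lambda>x. g (f x))"
  using assms(4,5)
proof (induction n arbitrary: g)
  case 0
  then show ?case using assms(3) continuous_on_compose2 by (metis times_differentiable_on.simps(1))
next
  case (Suc n)
  let ?f' = "\<lambda>x. frechet_derivative f (at x)" and ?g' = "\<lambda>x. frechet_derivative g (at (f x))"
  show ?case
  proof (rule times_differentiable_on_SucI[OF assms(1)])
    fix x assume x: "x \<in> S"
    then have f: "(f has_derivative ?f' x) (at x)" and g: "(g has_derivative ?g' x) (at (f x))"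
      using assms(3) times_differentiable_on_SucE(1) Suc.prems by blast+
    have "(\<lambda>v. ?g' x (?f' x v)) = (\<lambda>v. \<Sum>i\<in>Basis. (?f' x v \<bullet> i) *\<^sub>R ?g' x i)"
    proof
      fix v
      have "?g' x (?f' x v) = ?g' x (\<Sum>i\<in>Basis. (?f' x v \<bullet> i) *\<^sub>R i)"
        by (simp add: euclidean_representation)
      then show "?g' x (?f' x v) = (\<Sum>i\<in>Basis. (?f' x v \<bullet> i) *\<^sub>R ?g' x i)"
        by (simp only: linear_sum[OF has_derivative_linear[OF g]]
            linear_scale[OF has_derivative_linear[OF g]])
    qed
    then show "((\<lambda>x. g (f x)) has_derivative (\<lambda>v. \<Sum>i\<in>Basis. (?f' x v \<bullet> i) *\<^sub>R ?g' x i)) (at x)"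
      using has_derivative_compose[OF f g] by simp
  next
    fix v
    show "times_differentiable_on n S (\<lambda>x. \<Sum>i\<in>Basis. (?f' x v \<bullet> i) *\<^sub>R ?g' x i)"
      by (intro times_differentiable_on_sum assms(1)
          bounded_bilinear.times_differentiable_on_bilinear[OF bounded_bilinear_scaleR]
          bounded_bilinear.times_differentiable_on_bilinear[OF bounded_bilinear_inner]
          times_differentiable_on_const Suc.IH times_differentiable_on_SucE(2)[OF Suc.prems(1)]
          times_differentiable_on_SucE(2)[OF Suc.prems(2)]
          times_differentiable_on_SucD[OF Suc.prems(2)])
  qed
qed

section \<open>Closure properties of smoothness\<close>

lemma smooth_on_imp_continuous_on: "smooth_on S f \<Longrightarrow> continuous_on S f"
  unfolding smooth_on_def using times_differentiable_on_imp_continuous_on by blast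

lemma smooth_on_subset: "smooth_on S f \<Longrightarrow> T \<subseteq> S \<Longrightarrow> smooth_on T f"
  unfolding smooth_on_def using times_differentiable_on_subset by blast

lemma smooth_on_cong:
  "smooth_on S f \<Longrightarrow> open S \<Longrightarrow> (\<And>x. x \<in> S \<Longrightarrow> f x = g x) \<Longrightarrow> smooth_on S g"
  unfolding smooth_on_def using times_differentiable_on_cong by blast

lemma smooth_on_compose:
  fixes f :: "'a::real_normed_vector \<Rightarrow> 'b::euclidean_space"
  shows "smooth_on T g \<Longrightarrow> smooth_on S f \<Longrightarrow> open S \<Longrightarrow> open T \<Longrightarrow> f ` S \<subseteq> T
    \<Longrightarrow> smooth_on S (\<lambda>x. g (f x))"
  unfolding smooth_on_def using times_differentiable_on_compose by blast

lemma smooth_on_const: "open S \<Longrightarrow> smooth_on S (\<lambda>x. c)"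
  by (simp add: smooth_on_def times_differentiable_on_const)

lemma smooth_on_bounded_linear: "open S \<Longrightarrow> bounded_linear f \<Longrightarrow> smooth_on S f"
  by (simp add: smooth_on_def times_differentiable_on_bounded_linear)

lemmas smooth_on_fst = smooth_on_bounded_linear[OF _ bounded_linear_fst]
lemmas smooth_on_snd = smooth_on_bounded_linear[OF _ bounded_linear_snd]

lemma smooth_on_add:
  "open S \<Longrightarrow> smooth_on S f \<Longrightarrow> smooth_on S g \<Longrightarrow> smooth_on S (\<lambda>x. f x + g x)"
  by (simp add: smooth_on_def times_differentiable_on_add)

lemma smooth_on_Pair:
  "open S \<Longrightarrow> smooth_on S f \<Longrightarrow> smooth_on S g \<Longrightarrow> smooth_on S (\<lambda>x. (f x, g x))"
  by (simp add: smooth_on_def times_differentiable_on_Pair)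

lemma smooth_on_mult:
  fixes f g :: "'a::real_normed_vector \<Rightarrow> real"
  shows "open S \<Longrightarrow> smooth_on S f \<Longrightarrow> smooth_on S g \<Longrightarrow> smooth_on S (\<lambda>x. f x * g x)"
  using bounded_bilinear.times_differentiable_on_bilinear[OF bounded_bilinear_mult]
  unfolding smooth_on_def by blast

lemma smooth_on_diff:
  fixes f g :: "'a::real_normed_vector \<Rightarrow> real"
  assumes "open S" "smooth_on S f" "smooth_on S g"
  shows "smooth_on S (\<lambda>x. f x - g x)"
  using smooth_on_add[OF assms(1,2) smooth_on_mult[OF assms(1) smooth_on_const[of _ "-1"] assms(3)]]
    assms(1) by simp

lemma smooth_on_power2:
  fixes f :: "'a::real_normed_vector \<Rightarrow> real"
  shows "open S \<Longrightarrow> smooth_on S f \<Longrightarrow> smooth_on S (\<lambda>x. (f x)\<^sup>2)"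
  by (simp add: power2_eq_square smooth_on_mult)

section \<open>Smooth functions of one real variable\<close>

lemma smooth_on_antiderivative:
  fixes f :: "real \<Rightarrow> real"
  assumes "\<And>t. (F has_real_derivative f t) (at t)" "smooth_on UNIV f"
  shows "smooth_on UNIV F"
  unfolding smooth_on_def
proof
  fix n
  show "times_differentiable_on n UNIV F"
  proof (cases n)
    case 0
    then show ?thesis
      using DERIV_isCont[OF assms(1)] by (simp add: continuous_at_imp_continuous_on)
  next
    case (Suc m)
    \<comment> \<open>The derivative of \<open>F\<close> in direction \<open>v\<close> is
      \<open>f t * v\<close>, so the smoothness of \<open>f\<close> takes the place of an
      induction.\<close>
    have "times_differentiable_on m UNIV (\<lambda>t. f t * v)" for v
      using smooth_on_mult[OF _ assms(2) smooth_on_const[of _ v]] by (simp add: smooth_on_def)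
    then show ?thesis
      unfolding Suc
      using assms(1)
      by (intro times_differentiable_on_SucI[where f' = "\<lambda>t v. f t * v"])
        (auto simp: has_field_derivative_def)
  qed
qed

lemma smooth_on_has_real_derivative:
  fixes f :: "real \<Rightarrow> real"
  assumes "smooth_on UNIV f"
  shows "(f has_real_derivative deriv f t) (at t)"
proof -
  have "times_differentiable_on (Suc 0) UNIV f"
    using assms smooth_on_def by blast
  then show ?thesis
    by (auto simp: DERIV_deriv_iff_real_differentiable)
qed

lemma smooth_on_deriv:
  fixes f :: "real \<Rightarrow> real"
  assumes "smooth_on UNIV f"
  shows "smooth_on UNIV (deriv f)"
  unfolding smooth_on_def
proof
  fix n
  \<comment> \<open>Along the real line \<open>deriv\<close> is the derivative in direction 1, which
    the recursion controls.\<close>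
  have "deriv f = (\<lambda>t. frechet_derivative f (at t) 1)"
    using smooth_on_has_real_derivative[OF assms] frechet_derivative_eqI
    by (metis has_field_derivative_def mult.right_neutral)
  moreover have "times_differentiable_on (Suc n) UNIV f"
    using assms smooth_on_def by blast
  ultimately show "times_differentiable_on n UNIV (deriv f)"
    using times_differentiable_on_SucE(2) by metis
qed

lemma smooth_on_sin_cos: "smooth_on UNIV (sin :: real \<Rightarrow> real)" "smooth_on UNIV (cos :: real \<Rightarrow> real)"
proof -
  \<comment> \<open>This two-parameter family is closed under differentiation, and a direction
    \<open>v\<close> only changes the coefficients; hence both are arbitrary in the
    induction.\<close>
  have "times_differentiable_on n UNIV (\<lambda>t::real. a * sin t + b * cos t)" for n a b
  proof (induction n arbitrary: a b)
    case (Suc n)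
    show ?case
      by (rule times_differentiable_on_SucI[where f' = "\<lambda>t v. (- b * v) * sin t + (a * v) * cos t",
            OF _ _ Suc])
        (auto intro!: derivative_eq_intros simp: algebra_simps fun_eq_iff)
  qed (auto intro!: continuous_intros)
  from this[of _ 1 0] this[of _ 0 1] show
    "smooth_on UNIV (sin :: real \<Rightarrow> real)" "smooth_on UNIV (cos :: real \<Rightarrow> real)"
    by (simp_all add: smooth_on_def)
qed

text \<open>Multiples of powers are closed under differentiation. The exponent -1/2 will give the
  factor \<open>b\<close> of the normal coordinates.\<close>

lemma smooth_on_powr: "smooth_on {0<..} (\<lambda>t::real. t powr p)"
proof -
  have "times_differentiable_on n {0<..} (\<lambda>t::real. c * t powr p)" for n c p
  proof (induction n arbitrary: c p)
    case (Suc n)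
    show ?case
      by (rule times_differentiable_on_SucI[where f' = "\<lambda>t v. (c * p * v) * t powr (p - 1)",
            OF _ _ Suc])
        (auto intro!: derivative_eq_intros simp: fun_eq_iff powr_diff field_simps)
  qed (auto intro!: continuous_intros)
  from this[of _ 1 p] show ?thesis
    by (simp add: smooth_on_def)
qed

section \<open>Surfaces ruled by Legendrian lines\<close>

locale legendrian_ruling =
  fixes x y z :: "real \<Rightarrow> real"
  assumes smooth_curve: "smooth_on UNIV x" "smooth_on UNIV y" "smooth_on UNIV z"
begin

text \<open>\<open>along\<close> and \<open>across\<close> are the components of the projected velocity of the curve parallel
  and normal to the rule.\<close>

definition along :: "real \<Rightarrow> real" where
  "along \<theta> = deriv x \<theta> * cos \<theta> + deriv y \<theta> * sin \<theta>"

definition across :: "real \<Rightarrow> real" where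
  "across \<theta> = deriv y \<theta> * cos \<theta> - deriv x \<theta> * sin \<theta>"

definition zeta2 :: "real \<Rightarrow> real" where
  "zeta2 \<theta> = deriv z \<theta> + x \<theta> * deriv y \<theta> - y \<theta> * deriv x \<theta> - (across \<theta>)\<^sup>2"

abbreviation Y :: "plane \<Rightarrow> heis" where
  "Y \<equiv> ruled_surface x y z"

definition Y_r :: "plane \<Rightarrow> heis" where
  "Y_r q = (cos (snd q), sin (snd q), y (snd q) * cos (snd q) - x (snd q) * sin (snd q))"

text \<open>Written in closed form so that its frame components come from polynomial identities in
  sine and cosine; \<open>has_derivative_Y\<close> identifies it as the angular velocity.\<close>

definition Y_\<theta> :: "plane \<Rightarrow> heis" where
  "Y_\<theta> = (\<lambda>(r, \<theta>). (deriv x \<theta> - r * sin \<theta>, deriv y \<theta> + r * cos \<theta>,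
     deriv z \<theta> + r * (deriv y \<theta> * cos \<theta> - y \<theta> * sin \<theta>) - r * (deriv x \<theta> * sin \<theta> + x \<theta> * cos \<theta>)))"

text \<open>The \<open>D\<close> of the opening comment, a quadratic in \<open>r\<close> on each
  rule.\<close>

definition contact_height :: "plane \<Rightarrow> real" where
  "contact_height = (\<lambda>(r, \<theta>). (r + across \<theta>)\<^sup>2 + zeta2 \<theta>)"

section \<open>Smoothness and velocity of the ruled surface\<close>

lemma smooth_components:
  "smooth_on UNIV along" "smooth_on UNIV across" "smooth_on UNIV zeta2"
proof -
  note s = smooth_curve smooth_on_deriv[OF smooth_curve(1)] smooth_on_deriv[OF smooth_curve(2)]
    smooth_on_deriv[OF smooth_curve(3)] smooth_on_sin_cos
  show "smooth_on UNIV along" and c: "smooth_on UNIV across"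
    unfolding along_def [abs_def] across_def [abs_def]
    by (intro smooth_on_add smooth_on_diff smooth_on_mult s open_UNIV)+
  show "smooth_on UNIV zeta2"
    unfolding zeta2_def [abs_def]
    by (intro smooth_on_add smooth_on_diff smooth_on_mult smooth_on_power2 s c open_UNIV)
qed

lemma smooth_on_comp_snd:
  fixes f :: "real \<Rightarrow> real"
  shows "smooth_on UNIV f \<Longrightarrow> smooth_on UNIV (\<lambda>q :: plane. f (snd q))"
  by (rule smooth_on_compose[where T = UNIV]) (auto intro: smooth_on_snd)

lemma smooth_Y: "smooth_on UNIV Y" and smooth_Y_r: "smooth_on UNIV Y_r"
  unfolding ruled_surface_def case_prod_unfold Y_r_def [abs_def]
  by (intro smooth_on_Pair smooth_on_add smooth_on_diff smooth_on_mult smooth_on_comp_snd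
      smooth_on_sin_cos smooth_curve smooth_on_fst open_UNIV)+

lemma smooth_contact_height: "smooth_on UNIV contact_height"
  unfolding contact_height_def case_prod_unfold
  by (intro smooth_on_add smooth_on_power2 smooth_on_comp_snd smooth_components
      smooth_on_fst open_UNIV)

lemma has_derivative_Y:
  "(Y has_derivative (\<lambda>(u, v). u *\<^sub>R Y_r q + v *\<^sub>R Y_\<theta> q)) (at q)"
proof -
  have *: "((\<lambda>p :: plane. f (snd p)) has_derivative (\<lambda>w. deriv f (snd q) * snd w)) (at q)"
    if "smooth_on UNIV f" for f :: "real \<Rightarrow> real"
    using has_derivative_compose[OF bounded_linear_imp_has_derivative[OF bounded_linear_snd]
        smooth_on_has_real_derivative[OF that, unfolded has_field_derivative_def]] .
  show ?thesis
    unfolding ruled_surface_def case_prod_unfold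
    by (rule has_derivative_eq_rhs)
      (auto intro!: derivative_eq_intros *[OF smooth_curve(1)] *[OF smooth_curve(2)]
          *[OF smooth_curve(3)] ext
        simp: Y_r_def Y_\<theta>_def case_prod_unfold algebra_simps)
qed

lemma frechet_derivative_Y:
  "frechet_derivative Y (at q) (u, v) = u *\<^sub>R Y_r q + v *\<^sub>R Y_\<theta> q"
  using frechet_derivative_eqI[OF has_derivative_Y] by simp

section \<open>The contact form and the rotated frame along the surface\<close>

lemma contact_form_add: "contact_form p (v + w) = contact_form p v + contact_form p w"
  by (cases p; cases v; cases w) (simp add: contact_form_def algebra_simps)

lemma contact_form_scaleR: "contact_form p (u *\<^sub>R v) = u * contact_form p v"
  by (cases p; cases v) (simp add: contact_form_def algebra_simps)

lemma contact_form_Y_r: "contact_form (Y q) (Y_r q) = 0"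
  by (cases q) (simp add: contact_form_def ruled_surface_def Y_r_def algebra_simps)

lemma contact_form_Y_\<theta>: "contact_form (Y q) (Y_\<theta> q) = contact_height q"
proof -
  obtain r \<theta> where q: "q = (r, \<theta>)"
    by (cases q)
  \<comment> \<open>Keeping the coefficient of \<open>r\<^sup>2\<close> as a sum of squares makes
    this a pure polynomial identity. Afterwards it becomes 1, and completing the square absorbs the
    \<open>across\<close> term.\<close>
  have "contact_form (Y q) (Y_\<theta> q) = deriv z \<theta> + x \<theta> * deriv y \<theta> - y \<theta> * deriv x \<theta>
      + 2 * r * across \<theta> + r\<^sup>2 * ((sin \<theta>)\<^sup>2 + (cos \<theta>)\<^sup>2)"
    unfolding q contact_form_def ruled_surface_def Y_\<theta>_def across_def case_prod_conv
    by algebra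
  then show ?thesis
    by (simp add: q contact_height_def zeta2_def power2_sum)
qed

lemma Y_r_nonzero: "Y_r q \<noteq> 0"
  using sin_zero_abs_cos_one[of "snd q"] by (auto simp: Y_r_def zero_prod_def)

lemma field_e2_Y_r:
  "field_e2 Y Y_r q = (- sin (snd q), cos (snd q),
     - (fst (Y q) * cos (snd q) + fst (snd (Y q)) * sin (snd q)))"
  by (cases q) (simp add: field_e2_def heis_J_def left_X_def left_Y_def ruled_surface_def Y_r_def
      algebra_simps)

lemma contact_form_e2: "contact_form (Y q) (field_e2 Y Y_r q) = 0"
  unfolding field_e2_Y_r by (cases "Y q") (simp add: contact_form_def)

lemma contact_form_T: "contact_form p (left_T p) = 1"
  by (cases p) (simp add: left_T_def contact_form_def)

text \<open>The covector dual to \<open>field_e2\<close> in the frame \<open>Y_r\<close>,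
  \<open>field_e2\<close>, \<open>left_T\<close>. Like the contact form it kills \<open>Y_r\<close>,
  so the two together isolate the coefficient of \<open>Y_\<theta>\<close> in a tangent
  vector.\<close>

definition e2_component :: "plane \<Rightarrow> heis \<Rightarrow> real" where
  "e2_component q w = fst (snd w) * cos (snd q) - fst w * sin (snd q)"

text \<open>The frame is \<open>left_X\<close>, \<open>left_Y\<close> rotated by the angle, together
  with \<open>left_T\<close>. Both sides have the same first two coordinates and the same contact
  form, and these determine a vector by \<open>frame_decomposition\<close>.\<close>

lemma rotated_frame_decomposition:
  "w = (fst w * cos (snd q) + fst (snd w) * sin (snd q)) *\<^sub>R Y_r q
     + e2_component q w *\<^sub>R field_e2 Y Y_r q + contact_form (Y q) w *\<^sub>R left_T (Y q)" (is "w = ?W")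
proof -
  have T: "left_T p = (0, 0, 1)" for p
    by (cases p) (simp add: left_T_def)
  have "(sin (snd q))\<^sup>2 + (cos (snd q))\<^sup>2 = 1"
    by simp
  then have "fst w = fst ?W" "fst (snd w) = fst (snd ?W)"
    unfolding e2_component_def field_e2_Y_r Y_r_def T
      plus_prod_def scaleR_prod_def fst_conv snd_conv real_scaleR_def
    by algebra+
  moreover have "contact_form (Y q) ?W = contact_form (Y q) w"
    by (simp add: contact_form_add contact_form_scaleR contact_form_Y_r contact_form_e2
        contact_form_T)
  ultimately show ?thesis
    using frame_decomposition[of w "Y q"] frame_decomposition[of ?W "Y q"] by simp
qed

lemma e2_component_add: "e2_component q (v + w) = e2_component q v + e2_component q w"
  and e2_component_scaleR: "e2_component q (u *\<^sub>R v) = u * e2_component q v"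
  by (simp_all add: e2_component_def algebra_simps)

lemma e2_component_frame:
  "e2_component q (Y_r q) = 0" "e2_component q (left_T (Y q)) = 0"
  "e2_component q (field_e2 Y Y_r q) = 1" "e2_component q (Y_\<theta> q) = fst q + across (snd q)"
proof -
  have c: "(sin (snd q))\<^sup>2 + (cos (snd q))\<^sup>2 = 1"
    by simp
  show "e2_component q (Y_r q) = 0" "e2_component q (left_T (Y q)) = 0"
    by (simp_all add: e2_component_def Y_r_def left_T_def case_prod_unfold)
  show "e2_component q (field_e2 Y Y_r q) = 1"
    using c unfolding e2_component_def field_e2_Y_r fst_conv snd_conv by algebra
  show "e2_component q (Y_\<theta> q) = fst q + across (snd q)"
    using c unfolding e2_component_def Y_\<theta>_def across_def case_prod_unfold fst_conv snd_conv
    by algebra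
qed

lemma Y_\<theta>_frame:
  "Y_\<theta> q = along (snd q) *\<^sub>R Y_r q + (fst q + across (snd q)) *\<^sub>R field_e2 Y Y_r q
     + contact_height q *\<^sub>R left_T (Y q)"
proof -
  have "fst (Y_\<theta> q) * cos (snd q) + fst (snd (Y_\<theta> q)) * sin (snd q) = along (snd q)"
    by (simp add: Y_\<theta>_def along_def case_prod_unfold algebra_simps)
  then show ?thesis
    using rotated_frame_decomposition[of "Y_\<theta> q" q]
    by (simp add: e2_component_frame contact_form_Y_\<theta>)
qed

lemma tangent_plane_Y: "tangent_plane Y q = {u *\<^sub>R Y_r q + v *\<^sub>R Y_\<theta> q | u v. True}"
  unfolding tangent_plane_def by (auto simp: image_iff frechet_derivative_Y set_eq_iff)

lemma theta_sign_Y: "theta_sign Y q = sgn (contact_height q)"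
  by (simp add: theta_sign_def frechet_derivative_Y contact_form_Y_\<theta>)

end

section \<open>Nondegenerate curves: immersion, regular part and p-minimality\<close>

locale nondegenerate_ruling = legendrian_ruling +
  assumes zeta2_nonzero: "zeta2 \<theta> \<noteq> 0"
begin

text \<open>The square in \<open>contact_height\<close> must cancel the nonzero
  \<open>zeta2\<close>. So even where \<open>Y_\<theta>\<close> is a contact vector it has a
  component across the rule and stays independent of \<open>Y_r\<close>.\<close>

lemma singular_imp_transverse: "contact_height q = 0 \<Longrightarrow> fst q + across (snd q) \<noteq> 0"
  using zeta2_nonzero[of "snd q"] by (auto simp: contact_height_def case_prod_unfold)

lemma immersed_Y: "immersed_surface UNIV Y"
  unfolding immersed_surface_def
proof (intro conjI ballI open_UNIV smooth_Y)
  fix q :: plane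
  have "p = 0" if 0: "frechet_derivative Y (at q) p = 0" for p
  proof -
    obtain u v where p: "p = (u, v)"
      by (cases p)
    have uv: "u *\<^sub>R Y_r q + v *\<^sub>R Y_\<theta> q = 0"
      using 0 by (simp add: p frechet_derivative_Y)
    \<comment> \<open>The instance of \<open>contact_form_scaleR\<close> with scalar 0 evaluates the
      form at the zero vector; the same device is used for \<open>e2_component\<close>
      below.\<close>
    have "v * contact_height q = 0"
      using arg_cong[OF uv, of "contact_form (Y q)"] contact_form_scaleR[of "Y q" 0 0]
      by (simp add: contact_form_add contact_form_scaleR contact_form_Y_r contact_form_Y_\<theta>)
    moreover have "v * (fst q + across (snd q)) = 0"
      using arg_cong[OF uv, of "e2_component q"] e2_component_scaleR[of q 0 0]
      by (simp add: e2_component_add e2_component_scaleR e2_component_frame)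
    ultimately have "v = 0"
      using singular_imp_transverse mult_eq_0_iff by blast
    with uv Y_r_nonzero show "p = 0"
      by (auto simp: p zero_prod_def[where 'a = real and 'b = real])
  qed
  then show "inj (frechet_derivative Y (at q))"
    using linear_injective_0 has_derivative_linear[OF has_derivative_Y[of q]]
      frechet_derivative_at[OF has_derivative_Y[of q]] by metis
qed

lemma regular_part_Y: "regular_part UNIV Y = {q. contact_height q \<noteq> 0}"
proof -
  have "tangent_plane Y q = contact_plane (Y q)" if 0: "contact_height q = 0" for q
  proof
    show "tangent_plane Y q \<subseteq> contact_plane (Y q)"
      using 0 by (auto simp: tangent_plane_Y contact_plane_def contact_form_add contact_form_scaleR
          contact_form_Y_r contact_form_Y_\<theta>)
  next
    define m where "m = fst q + across (snd q)"
    \<comment> \<open>At a singular point the \<open>left_T\<close> term of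
      \<open>Y_\<theta>_frame\<close> disappears and \<open>m\<close> is nonzero, so the formula can
      be solved for \<open>field_e2\<close>.\<close>
    have e2: "field_e2 Y Y_r q = (- along (snd q) / m) *\<^sub>R Y_r q + (1 / m) *\<^sub>R Y_\<theta> q"
      using singular_imp_transverse[OF 0] 0
      unfolding Y_\<theta>_frame m_def by (simp add: scaleR_add_right)
    show "contact_plane (Y q) \<subseteq> tangent_plane Y q"
    proof
      fix w assume "w \<in> contact_plane (Y q)"
      then obtain a b where "w = a *\<^sub>R Y_r q + b *\<^sub>R field_e2 Y Y_r q"
        using rotated_frame_decomposition[of w q] by (auto simp: contact_plane_def)
      then have "w = (a - b * along (snd q) / m) *\<^sub>R Y_r q + (b / m) *\<^sub>R Y_\<theta> q"
        unfolding e2 by (simp add: algebra_simps)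
      then show "w \<in> tangent_plane Y q"
        unfolding tangent_plane_Y by blast
    qed
  qed
  moreover have "tangent_plane Y q \<noteq> contact_plane (Y q)" if "contact_height q \<noteq> 0" for q
  proof -
    have "0 *\<^sub>R Y_r q + 1 *\<^sub>R Y_\<theta> q \<in> tangent_plane Y q"
      unfolding tangent_plane_Y by blast
    moreover have "Y_\<theta> q \<notin> contact_plane (Y q)"
      using that by (simp add: contact_plane_def contact_form_Y_\<theta>)
    ultimately show ?thesis
      by auto
  qed
  ultimately show ?thesis
    by (auto simp: regular_part_def)
qed

lemma characteristic_field_Y_r: "characteristic_field UNIV Y Y_r"
  unfolding characteristic_field_def
proof (intro conjI ballI IntI)
  show "smooth_on (regular_part UNIV Y) Y_r"
    using smooth_on_subset[OF smooth_Y_r] by simp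
  fix q
  have "1 *\<^sub>R Y_r q + 0 *\<^sub>R Y_\<theta> q \<in> tangent_plane Y q"
    unfolding tangent_plane_Y by blast
  then show "Y_r q \<in> tangent_plane Y q"
    by simp
  show "Y_r q \<in> contact_plane (Y q)"
    by (simp add: contact_plane_def contact_form_Y_r)
  show "adapted_metric (Y q) (Y_r q) (Y_r q) = 1"
    by (simp add: adapted_metric_def contact_form_Y_r) (simp add: Y_r_def flip: power2_eq_square)
qed

text \<open>The frame components of \<open>field_e2\<close> are minus the sine, the cosine and 0.
  They depend on the angle alone, hence are constant along each rule.\<close>

lemma cov_deriv_e2: "cov_deriv Y (field_e2 Y Y_r) q (1, 0) = 0"
proof -
  have D: "frechet_derivative (\<lambda>p :: plane. - sin (snd p)) (at q) (1, 0) = 0"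
    "frechet_derivative (\<lambda>p :: plane. cos (snd p)) (at q) (1, 0) = 0"
    by (rule trans[OF frechet_derivative_eqI], (rule derivative_intros)+, simp)+
  show ?thesis
    unfolding cov_deriv_def contact_form_e2 using D by (simp add: field_e2_Y_r)
qed

text \<open>The definite description needs uniqueness: the immersion forces the parameter direction
  to be \<open>(1, 0)\<close>, and then a multiple of the nonzero \<open>Y_r\<close>
  vanishes.\<close>

lemma p_mean_curvature_Y: "p_mean_curvature Y Y_r q = 0"
  unfolding p_mean_curvature_def
proof (rule the_equality)
  have e: "frechet_derivative Y (at q) (1, 0) = Y_r q"
    by (simp add: frechet_derivative_Y)
  then show "\<exists>u. frechet_derivative Y (at q) u = Y_r q \<and>
      cov_deriv Y (field_e2 Y Y_r) q u = - (0 *\<^sub>R Y_r q)"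
    using cov_deriv_e2[of q] by (intro exI[of _ "(1, 0)"]) simp
  fix H assume "\<exists>u. frechet_derivative Y (at q) u = Y_r q \<and>
      cov_deriv Y (field_e2 Y Y_r) q u = - (H *\<^sub>R Y_r q)"
  then obtain u where u: "frechet_derivative Y (at q) u = Y_r q"
    "cov_deriv Y (field_e2 Y Y_r) q u = - (H *\<^sub>R Y_r q)"
    by blast
  have "u = (1, 0)"
    using immersed_Y u(1) e by (metis immersed_surface_def injD UNIV_I)
  then show "H = 0"
    using u(2) cov_deriv_e2 Y_r_nonzero by simp
qed

lemma p_minimal_Y: "p_minimal UNIV Y Y_r"
  by (simp add: p_minimal_def immersed_Y characteristic_field_Y_r p_mean_curvature_Y)

section \<open>The function \<alpha>\<close>

lemma alpha_fun_tangent: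
  assumes "contact_height q \<noteq> 0"
  shows "((fst q + across (snd q)) / contact_height q) *\<^sub>R field_e2 Y Y_r q + left_T (Y q)
    = (1 / contact_height q) *\<^sub>R (Y_\<theta> q - along (snd q) *\<^sub>R Y_r q)"
  using assms by (simp add: Y_\<theta>_frame scaleR_add_right)

lemma alpha_fun_Y:
  assumes "contact_height q \<noteq> 0"
  shows "alpha_fun Y Y_r q = (fst q + across (snd q)) / contact_height q"
  unfolding alpha_fun_def
proof (rule the_equality)
  have "((fst q + across (snd q)) / contact_height q) *\<^sub>R field_e2 Y Y_r q + left_T (Y q)
    = (- along (snd q) / contact_height q) *\<^sub>R Y_r q + (1 / contact_height q) *\<^sub>R Y_\<theta> q"
    unfolding alpha_fun_tangent[OF assms] by (simp add: scaleR_diff_right)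
  then show "((fst q + across (snd q)) / contact_height q) *\<^sub>R field_e2 Y Y_r q + left_T (Y q)
      \<in> tangent_plane Y q"
    unfolding tangent_plane_Y by blast
  fix a assume "a *\<^sub>R field_e2 Y Y_r q + left_T (Y q) \<in> tangent_plane Y q"
  then obtain u v where uv: "a *\<^sub>R field_e2 Y Y_r q + left_T (Y q) = u *\<^sub>R Y_r q + v *\<^sub>R Y_\<theta> q"
    unfolding tangent_plane_Y by blast
  \<comment> \<open>Comparing contact forms determines \<open>v\<close>; comparing components along
    \<open>field_e2\<close> then determines \<open>a\<close>.\<close>
  have "1 = v * contact_height q"
    using arg_cong[OF uv, of "contact_form (Y q)"]
    by (simp add: contact_form_add contact_form_scaleR contact_form_Y_r contact_form_Y_\<theta>
        contact_form_e2 contact_form_T)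
  moreover have "a = v * (fst q + across (snd q))"
    using arg_cong[OF uv, of "e2_component q"]
    by (simp add: e2_component_add e2_component_scaleR e2_component_frame)
  ultimately show "a = (fst q + across (snd q)) / contact_height q"
    using assms by (metis mult.commute nonzero_eq_divide_eq mult_1 mult.assoc)
qed

section \<open>Coordinates that shift each rule and orient the angle\<close>

definition chart :: "(real \<Rightarrow> real) \<Rightarrow> real \<Rightarrow> plane \<Rightarrow> plane" where
  "chart G \<sigma> q = (fst q + G (snd q), \<sigma> * snd q)"

text \<open>Multiplication by \<sigma> undoes itself because \<sigma> will be a sign, assumed below
  in the form \<open>\<sigma> * \<sigma> = 1\<close>.\<close>

definition chart_inv :: "(real \<Rightarrow> real) \<Rightarrow> real \<Rightarrow> plane \<Rightarrow> plane" where
  "chart_inv G \<sigma> p = (fst p - G (\<sigma> * snd p), \<sigma> * snd p)"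

context
  fixes G :: "real \<Rightarrow> real" and \<sigma> :: real and W :: "plane set"
  assumes G: "smooth_on UNIV G" and \<sigma>: "\<sigma> * \<sigma> = 1"
    and W: "open W" "W \<subseteq> regular_part UNIV Y"
begin

lemma chart_inverse: "chart_inv G \<sigma> (chart G \<sigma> q) = q" "chart G \<sigma> (chart_inv G \<sigma> q) = q"
  using \<sigma> by (simp_all add: chart_def chart_inv_def flip: mult.assoc)

lemma smooth_comp_scaled:
  fixes f :: "real \<Rightarrow> real"
  shows "smooth_on UNIV f \<Longrightarrow> smooth_on UNIV (\<lambda>t. f (\<sigma> * t))"
  by (rule smooth_on_compose[where T = UNIV])
    (auto intro: smooth_on_bounded_linear bounded_linear_mult_right)

lemma smooth_chart: "smooth_on UNIV (chart G \<sigma>)" "smooth_on UNIV (chart_inv G \<sigma>)"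
  unfolding chart_def [abs_def] chart_inv_def [abs_def]
  by (intro smooth_on_Pair smooth_on_add smooth_on_diff smooth_on_mult smooth_on_const
      smooth_on_comp_snd[OF G] smooth_on_comp_snd[OF smooth_comp_scaled[OF G]]
      smooth_on_fst smooth_on_snd open_UNIV)+

text \<open>As a preimage under the continuous inverse chart, the image of \<open>W\<close> is
  open.\<close>

lemma chart_image: "chart G \<sigma> ` W = chart_inv G \<sigma> -` W"
  by (force simp: chart_inverse image_iff intro: chart_inverse(2)[symmetric])

lemma open_chart_image: "open (chart G \<sigma> ` W)"
  unfolding chart_image
  using W(1) smooth_on_imp_continuous_on[OF smooth_chart(2)]
  by (simp add: continuous_on_open_vimage)

lemma inj_chart: "inj_on (chart G \<sigma>) W"
  by (metis chart_inverse(1) inj_onI)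

lemma inv_into_chart: "p \<in> chart G \<sigma> ` W \<Longrightarrow> inv_into W (chart G \<sigma>) p = chart_inv G \<sigma> p"
  using inv_into_f_f[OF inj_chart] chart_inverse(1) by auto

lemma coordinates_on_chart: "coordinates_on W (chart G \<sigma>)"
  unfolding coordinates_on_def
  using W(1) smooth_on_subset[OF smooth_chart(1), of W] inj_chart open_chart_image
    smooth_on_cong[OF smooth_on_subset[OF smooth_chart(2)] open_chart_image] inv_into_chart
  by auto

lemma has_derivative_chart_inv:
  "(chart_inv G \<sigma> has_derivative (\<lambda>w. (fst w - deriv G (snd q) * (\<sigma> * snd w), \<sigma> * snd w)))
    (at (chart G \<sigma> q))"
proof -
  have "\<sigma> * snd (chart G \<sigma> q) = snd q"
    using \<sigma> by (simp add: chart_def flip: mult.assoc)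
  then have "((\<lambda>p. G (\<sigma> * snd p)) has_derivative (\<lambda>w. deriv G (snd q) * (\<sigma> * snd w)))
      (at (chart G \<sigma> q))"
    using has_derivative_compose[OF bounded_linear_imp_has_derivative[OF
          bounded_linear_const_mult[OF bounded_linear_snd, of \<sigma>]], of G]
      smooth_on_has_real_derivative[OF G, of "snd q", unfolded has_field_derivative_def]
    by metis
  then show ?thesis
    unfolding chart_inv_def [abs_def] by (auto intro!: derivative_eq_intros)
qed

text \<open>The shift by \<open>G\<close> leaves the radial field alone and subtracts a multiple of
  it from the angular one. When the derivative of \<open>G\<close> is \<open>along\<close>, this
  removes exactly the part of \<open>Y_\<theta>\<close> parallel to the rule.\<close>

lemma coordinate_fields:
  assumes "q \<in> W"
  shows "coord_x Y W (chart G \<sigma>) q = Y_r q"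
    and "coord_y Y W (chart G \<sigma>) q = \<sigma> *\<^sub>R (Y_\<theta> q - deriv G (snd q) *\<^sub>R Y_r q)"
proof -
  have "(Y has_derivative (\<lambda>(u, v). u *\<^sub>R Y_r q + v *\<^sub>R Y_\<theta> q))
      (at (chart_inv G \<sigma> (chart G \<sigma> q)))"
    by (simp add: chart_inverse has_derivative_Y)
  from has_derivative_compose[OF has_derivative_chart_inv this]
  have "((\<lambda>p. Y (chart_inv G \<sigma> p)) has_derivative (\<lambda>w. (fst w - deriv G (snd q) * (\<sigma> * snd w)) *\<^sub>R Y_r q
      + (\<sigma> * snd w) *\<^sub>R Y_\<theta> q)) (at (chart G \<sigma> q))"
    by simp
  \<comment> \<open>\<open>inv_into\<close> is known to equal \<open>chart_inv\<close> only on the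
    chart image, whose openness carries the derivative over.\<close>
  then have D: "(Y \<circ> inv_into W (chart G \<sigma>) has_derivative
      (\<lambda>w. (fst w - deriv G (snd q) * (\<sigma> * snd w)) *\<^sub>R Y_r q + (\<sigma> * snd w) *\<^sub>R Y_\<theta> q))
      (at (chart G \<sigma> q))"
    by (rule has_derivative_transform_within_open[OF _ open_chart_image])
      (use assms in \<open>auto simp: inv_into_chart\<close>)
  show "coord_x Y W (chart G \<sigma>) q = Y_r q"
    "coord_y Y W (chart G \<sigma>) q = \<sigma> *\<^sub>R (Y_\<theta> q - deriv G (snd q) *\<^sub>R Y_r q)"
    unfolding coord_x_def coord_y_def frechet_derivative_eqI[OF D]
    by (simp_all add: scaleR_diff_right mult.commute)
qed

text \<open>Since \<open>r\<close> equals \<open>s\<close> minus the shift, the quantity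
  \<open>r + across\<close> turns into \<open>s + (across - G)\<close>; this is where the first
  invariant acquires its antiderivative.\<close>

lemma general_type_coordinates_chart:
  "general_type_coordinates UNIV Y Y_r W (chart G \<sigma>)
     (\<lambda>t. across (\<sigma> * t) - G (\<sigma> * t)) (\<lambda>t. zeta2 (\<sigma> * t))"
  unfolding general_type_coordinates_def
proof (intro conjI ballI allI impI W(2) coordinates_on_chart zeta2_nonzero)
  show "smooth_on (snd ` chart G \<sigma> ` W) (\<lambda>t. across (\<sigma> * t) - G (\<sigma> * t))"
    "smooth_on (snd ` chart G \<sigma> ` W) (\<lambda>t. zeta2 (\<sigma> * t))"
    by (rule smooth_on_subset[OF _ subset_UNIV],
        intro smooth_on_diff smooth_comp_scaled smooth_components G open_UNIV)+
  fix q s t assume q: "q \<in> W" and st: "chart G \<sigma> q = (s, t)"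
  have h: "contact_height q \<noteq> 0"
    using q W(2) by (auto simp: regular_part_Y)
  have q_eq: "fst q = s - G (\<sigma> * t)" "snd q = \<sigma> * t"
    using chart_inverse(1)[of q] by (auto simp: st chart_inv_def)
  show "Y_r q = coord_x Y W (chart G \<sigma>) q"
    by (simp add: coordinate_fields[OF q])
  have h_eq: "contact_height q = (s + (across (\<sigma> * t) - G (\<sigma> * t)))\<^sup>2 + zeta2 (\<sigma> * t)"
    by (simp add: contact_height_def case_prod_unfold q_eq algebra_simps)
  with h show "(s + (across (\<sigma> * t) - G (\<sigma> * t)))\<^sup>2 + zeta2 (\<sigma> * t) \<noteq> 0"
    by simp
  show "alpha_fun Y Y_r q = (s + (across (\<sigma> * t) - G (\<sigma> * t))) /
      ((s + (across (\<sigma> * t) - G (\<sigma> * t)))\<^sup>2 + zeta2 (\<sigma> * t))"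
    unfolding alpha_fun_Y[OF h] h_eq by (simp add: q_eq)
qed

lemma normal_coordinates_chart:
  assumes G': "\<And>\<theta>. (G has_real_derivative along \<theta>) (at \<theta>)"
    and sgn: "\<And>q. q \<in> W \<Longrightarrow> sgn (contact_height q) = \<sigma>"
  shows "normal_coordinates UNIV Y Y_r W (chart G \<sigma>)
     (\<lambda>t. across (\<sigma> * t) - G (\<sigma> * t)) (\<lambda>t. zeta2 (\<sigma> * t))"
proof -
  define m where "m = (\<lambda>q. fst q + across (snd q))"
  define h where "h = (\<lambda>q. (contact_height q)\<^sup>2 + (m q)\<^sup>2)"
  \<comment> \<open>Unlike the quotient prescribed for \<open>b\<close>, this power is smooth also
    where \<open>m\<close> vanishes, because \<open>h\<close> is positive on the whole
    plane.\<close>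
  define b where "b = (\<lambda>p. h (chart_inv G \<sigma> p) powr (- (1 / 2)))"
  have h_pos: "h q > 0" for q
    using singular_imp_transverse[of q] by (auto simp: h_def m_def sum_power2_gt_zero_iff)
  have "smooth_on UNIV h"
    unfolding h_def m_def
    by (intro smooth_on_add smooth_on_power2 smooth_contact_height smooth_on_fst
        smooth_on_comp_snd smooth_components open_UNIV)
  then have "smooth_on UNIV (\<lambda>p. h (chart_inv G \<sigma> p))"
    using smooth_on_compose[OF _ smooth_chart(2)] by blast
  then have "smooth_on UNIV b"
    unfolding b_def
    by (rule smooth_on_compose[OF smooth_on_powr]) (auto intro: h_pos)
  then have "smooth_on (chart G \<sigma> ` W) b"
    by (rule smooth_on_subset) simp
  moreover have "b (s, t) > 0 \<and>
      field_e2_hat Y Y_r q = b (s, t) *\<^sub>R coord_y Y W (chart G \<sigma>) q \<and>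
      (s + (across (\<sigma> * t) - G (\<sigma> * t)) \<noteq> 0 \<longrightarrow> b (s, t) = \<bar>alpha_fun Y Y_r q\<bar> /
        (\<bar>s + (across (\<sigma> * t) - G (\<sigma> * t))\<bar> * sqrt (1 + (alpha_fun Y Y_r q)\<^sup>2)))"
    if q: "q \<in> W" and st: "chart G \<sigma> q = (s, t)" for q s t
  proof -
    have nz: "contact_height q \<noteq> 0"
      using q W(2) by (auto simp: regular_part_Y)
    have inv: "chart_inv G \<sigma> (s, t) = q"
      using chart_inverse(1) st by metis
    have m_eq: "s + (across (\<sigma> * t) - G (\<sigma> * t)) = m q"
      by (simp add: m_def chart_inv_def flip: inv)
    have \<alpha>: "alpha_fun Y Y_r q = m q / contact_height q"
      unfolding m_def by (rule alpha_fun_Y[OF nz])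
    have "1 + (alpha_fun Y Y_r q)\<^sup>2 = h q / (contact_height q)\<^sup>2"
      using nz by (simp add: \<alpha> h_def field_simps)
    then have root: "sqrt (1 + (alpha_fun Y Y_r q)\<^sup>2) = sqrt (h q) / \<bar>contact_height q\<bar>"
      by (simp add: real_sqrt_divide)
    have b: "b (s, t) = 1 / sqrt (h q)"
      using h_pos[of q] by (simp add: b_def inv powr_minus_divide powr_half_sqrt)
    \<comment> \<open>Writing the sign as a quotient lets \<sigma> turn
      \<open>contact_height q\<close> into its absolute value.\<close>
    have \<sigma>_eq: "\<sigma> = \<bar>contact_height q\<bar> / contact_height q"
      using sgn[OF q] nz by (simp add: sgn_if split: if_splits)
    have "deriv G (snd q) = along (snd q)"
      using G' DERIV_imp_deriv by blast
    then have "coord_y Y W (chart G \<sigma>) q = (\<sigma> * contact_height q) *\<^sub>R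
        (alpha_fun Y Y_r q *\<^sub>R field_e2 Y Y_r q + left_T (Y q))"
      using nz unfolding coordinate_fields[OF q] \<alpha> m_def alpha_fun_tangent[OF nz] by simp
    also have "\<sigma> * contact_height q = \<bar>contact_height q\<bar>"
      using nz by (simp add: \<sigma>_eq)
    finally have "field_e2_hat Y Y_r q = b (s, t) *\<^sub>R coord_y Y W (chart G \<sigma>) q"
      unfolding field_e2_hat_def root b by simp
    \<comment> \<open>Here \<open>m q\<close> cancels against the numerator of \<alpha>, and
      \<open>contact_height q\<close> against the denominator of the root.\<close>
    moreover have "b (s, t) = \<bar>alpha_fun Y Y_r q\<bar> / (\<bar>m q\<bar> * sqrt (1 + (alpha_fun Y Y_r q)\<^sup>2))"
      if "m q \<noteq> 0"
      unfolding root b using that nz by (simp add: \<alpha> abs_divide)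
    ultimately show ?thesis
      using h_pos[of q] by (simp add: m_eq b)
  qed
  ultimately show ?thesis
    unfolding normal_coordinates_def using general_type_coordinates_chart by blast
qed

end

section \<open>General type on the regular part, and the sign regions\<close>

lemma open_regular_part_Y: "open (regular_part UNIV Y)"
  unfolding regular_part_Y
  using smooth_on_imp_continuous_on[OF smooth_contact_height]
  by (intro open_Collect_neq) auto

text \<open>The original parameters already serve: with zero shift and sign 1 a single chart covers
  the whole regular part.\<close>

lemma p_minimal_general_type_Y: "p_minimal_general_type UNIV Y Y_r"
  unfolding p_minimal_general_type_def
  using p_minimal_Y general_type_coordinates_chart[OF smooth_on_const[OF open_UNIV, of 0] _
      open_regular_part_Y subset_refl, of 1] by fastforce

text \<open>Normal coordinates have to live on an open set. On the regular part the sign is 1 or -1,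
  so any other \<sigma> gives the empty region.\<close>

lemma open_sign_region: "open {p \<in> regular_part UNIV Y. theta_sign Y p = \<sigma>}"
proof -
  have c: "continuous_on UNIV contact_height"
    by (rule smooth_on_imp_continuous_on[OF smooth_contact_height])
  consider "\<sigma> = 1" | "\<sigma> = -1" | "\<sigma> \<noteq> 1" "\<sigma> \<noteq> -1"
    by blast
  then show ?thesis
  proof cases
    case 1
    then have "{p \<in> regular_part UNIV Y. theta_sign Y p = \<sigma>} = {p. 0 < contact_height p}"
      by (auto simp: regular_part_Y theta_sign_Y sgn_if)
    then show ?thesis
      using c by (simp add: open_Collect_less)
  next
    case 2
    then have "{p \<in> regular_part UNIV Y. theta_sign Y p = \<sigma>} = {p. contact_height p < 0}"
      by (auto simp: regular_part_Y theta_sign_Y sgn_if)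
    then show ?thesis
      using c by (simp add: open_Collect_less)
  next
    case 3
    then have "{p \<in> regular_part UNIV Y. theta_sign Y p = \<sigma>} = {}"
      by (auto simp: regular_part_Y theta_sign_Y sgn_if)
    then show ?thesis
      by (metis open_empty)
  qed
qed

end

theorem mainTheorem11:
  fixes x y z :: "real \<Rightarrow> real"
    and Y :: "plane \<Rightarrow> heis" and Y_r :: "plane \<Rightarrow> heis" and \<zeta>2 :: "real \<Rightarrow> real"
  assumes "smooth_on UNIV x" and "smooth_on UNIV y" and "smooth_on UNIV z"
    and "Y = ruled_surface x y z"
    and "Y_r = (\<lambda>q. frechet_derivative Y (at q) (1, 0))"
    and "\<zeta>2 = (\<lambda>\<theta>. deriv z \<theta> + x \<theta> * deriv y \<theta> - y \<theta> * deriv x \<theta>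
                 - (deriv y \<theta> * cos \<theta> - deriv x \<theta> * sin \<theta>)\<^sup>2)"
    and "\<forall>\<theta>. \<zeta>2 \<theta> \<noteq> 0"
  shows "p_minimal_general_type UNIV Y Y_r \<and>
    (\<forall>G \<zeta>1.
       (\<forall>\<theta>. (G has_real_derivative deriv x \<theta> * cos \<theta> + deriv y \<theta> * sin \<theta>) (at \<theta>)) \<longrightarrow>
       \<zeta>1 = (\<lambda>\<theta>. deriv y \<theta> * cos \<theta> - deriv x \<theta> * sin \<theta> - G \<theta>) \<longrightarrow>
       (\<forall>q \<in> regular_part UNIV Y. \<forall>\<sigma> W.
          \<sigma> = theta_sign Y q \<longrightarrow>
          W = {p \<in> regular_part UNIV Y. theta_sign Y p = \<sigma>} \<longrightarrow>
          (\<exists>\<phi>. (\<forall>r \<theta>. (r, \<theta>) \<in> W \<longrightarrow> snd (\<phi> (r, \<theta>)) = \<sigma> * \<theta>) \<and>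
               normal_coordinates UNIV Y Y_r W \<phi> (\<lambda>t. \<zeta>1 (\<sigma> * t)) (\<lambda>t. \<zeta>2 (\<sigma> * t)))))"
proof -
  interpret R: legendrian_ruling x y z
    by unfold_locales (use assms in auto)
  have \<zeta>2: "\<zeta>2 = R.zeta2"
    using assms(6) by (simp add: R.zeta2_def R.across_def fun_eq_iff)
  interpret R: nondegenerate_ruling x y z
    by unfold_locales (use assms(7) \<zeta>2 in auto)
  have Y_r: "Y_r = R.Y_r"
    unfolding assms(4,5) by (intro ext) (simp only: R.frechet_derivative_Y, simp)
  have "\<exists>\<phi>. (\<forall>r \<theta>. (r, \<theta>) \<in> W \<longrightarrow> snd (\<phi> (r, \<theta>)) = \<sigma> * \<theta>) \<and>
      normal_coordinates UNIV Y Y_r W \<phi> (\<lambda>t. \<zeta>1 (\<sigma> * t)) (\<lambda>t. \<zeta>2 (\<sigma> * t))"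
    if G: "\<forall>\<theta>. (G has_real_derivative deriv x \<theta> * cos \<theta> + deriv y \<theta> * sin \<theta>) (at \<theta>)"
      and \<zeta>1: "\<zeta>1 = (\<lambda>\<theta>. deriv y \<theta> * cos \<theta> - deriv x \<theta> * sin \<theta> - G \<theta>)"
      and q: "q \<in> regular_part UNIV Y" and \<sigma>: "\<sigma> = theta_sign Y q"
      and W: "W = {p \<in> regular_part UNIV Y. theta_sign Y p = \<sigma>}"
    for G \<zeta>1 q \<sigma> W
  proof (intro exI conjI allI impI)
    \<comment> \<open>The witness is the chart shifted by the given antiderivative and oriented by
      the sign at \<open>q\<close>.\<close>
    show "snd (R.chart G \<sigma> (r, \<theta>)) = \<sigma> * \<theta>" for r \<theta>
      by (simp add: R.chart_def)
    have G': "(G has_real_derivative R.along \<theta>) (at \<theta>)" for \<theta>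
      using G by (simp add: R.along_def)
    have "\<sigma> * \<sigma> = 1"
      using q unfolding \<sigma> assms(4) by (auto simp: R.regular_part_Y R.theta_sign_Y sgn_if)
    \<comment> \<open>The smoothness of \<open>G\<close> comes from that of its derivative
      \<open>along\<close>; the region supplies the constant sign that the normal form
      requires.\<close>
    then have "normal_coordinates UNIV (ruled_surface x y z) R.Y_r W (R.chart G \<sigma>)
        (\<lambda>t. R.across (\<sigma> * t) - G (\<sigma> * t)) (\<lambda>t. R.zeta2 (\<sigma> * t))"
      using R.open_sign_region[of \<sigma>] G' W
      by (intro R.normal_coordinates_chart)
        (auto simp: assms(4) R.theta_sign_Y
          intro: smooth_on_antiderivative[OF _ R.smooth_components(1)])
    then show "normal_coordinates UNIV Y Y_r W (R.chart G \<sigma>)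
        (\<lambda>t. \<zeta>1 (\<sigma> * t)) (\<lambda>t. \<zeta>2 (\<sigma> * t))"
      by (simp add: \<zeta>1 \<zeta>2 Y_r assms(4) R.across_def)
  qed
  then show ?thesis
    using R.p_minimal_general_type_Y unfolding Y_r assms(4) by blast
qed

end
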